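(* Let $U_1,U_2,\dots$ be i.i.d. uniform random variables on $[0,1]$ and let $T$ be the least $t\ge 3$ with $U_{t-2}<U_{t-1}<U_t$ (the limiting case, as $n\to\infty$, of rolling a fair $n$-sided die until three consecutive increasing values are seen). Let $S=\sin\left(\frac{\sqrt3}{2}\right)$ and $C=\cos\left(\frac{\sqrt3}{2}\right)$. Then the expectation $\mu$ and the variance of $T$ are \[\mu = \frac{\sqrt{3e}}{\sqrt3\,C - S},\qquad \operatorname{Var} = \frac{9\sqrt{e}\,C + \sqrt{3e}\,S - 3e}{(\sqrt3\,C-S)^2},\] with numerical values $\mu = 7.9243724345\ldots$ and $\operatorname{Var}=27.9813314059\ldots$. *)

theory Defs
  imports "HOL-Probability.Probability"
begin

definition increasing_triple_at :: "(nat \<Rightarrow> real) \<Rightarrow> nat \<Rightarrow> bool" where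
  "increasing_triple_at u t \<longleftrightarrow> t \<ge> 3 \<and> u (t - 2) < u (t - 1) \<and> u (t - 1) < u t"

(* Meaningful only for sequences in which an increasing triple occurs; on the others
   LEAST returns an unspecified number. Sequences are read from index 1 on. *)
definition first_increasing_triple :: "(nat \<Rightarrow> real) \<Rightarrow> nat" where
  "first_increasing_triple u = (LEAST t. increasing_triple_at u t)"

end

theory Submission
  imports Defs
begin

text \<open>
  Let \<open>p n\<close> be the probability that \<open>U 1, \<dots>, U n\<close> contain no increasing triple, that is,
  that the waiting time exceeds \<open>n\<close>. Then the mean is \<open>\<Sum>n. p n\<close> and the second moment is
  \<open>\<Sum>n. (2 * n + 1) * p n\<close>, so everything follows from the values at \<open>1\<close> of the generating function
  of \<open>p\<close> and of its derivative.

  The reciprocal of that generating function is the entire function \<open>\<Sum>k. c k * x ^ k\<close>, where \<open>c k\<close>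
  is \<open>1 / k!\<close>, \<open>- 1 / k!\<close> or \<open>0\<close> as \<open>k\<close> is \<open>0\<close>, \<open>1\<close> or \<open>2\<close> modulo \<open>3\<close>. To see this, consider the event
  that there is no triple up to \<open>n\<close> and that the values at \<open>n + 1, \<dots>, N\<close> increase. By independence its
  probability is \<open>p n / (N - n)!\<close> (\<open>prob_ascends_after\<close>). If there is no triple up to \<open>n + 1\<close> and
  the values increase from \<open>n + 2\<close> on, there are two possibilities. Either the first triple ends
  exactly at \<open>n + 4\<close>, or \<open>U (n + 1) < U (n + 2)\<close>, so that the increasing run already starts at
  \<open>n + 1\<close>. The second case is the same kind of event for \<open>n\<close>, minus the case that the first triple
  ends at \<open>n + 1\<close> (\<open>ascends_into_step\<close>). Going down from \<open>n\<close> to \<open>n - 3\<close>, \<open>n - 6\<close>, \<open>\<dots>\<close> in this way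
  expresses the probability \<open>p n - p (n + 1)\<close> that the first triple ends at \<open>n + 1\<close> by
  \<open>p 0, \<dots>, p (n - 1)\<close> with alternating signs, which is the convolution identity \<open>p * c = 1\<close>
  (\<open>survival_convolution\<close>).

  Three consecutive fresh values form a triple with probability \<open>1 / 6\<close>, so \<open>p\<close> decays
  geometrically, and the identity and its derivative may be evaluated at \<open>1\<close> by Cauchy products. The
  signs are \<open>Re (a * w ^ k)\<close> for a primitive cube root of unity \<open>w\<close>, so the values at \<open>1\<close> of
  \<open>\<Sum>k. c k * x ^ k\<close> and its derivative are \<open>Re (a * exp w)\<close> and \<open>Re (a * w * exp w)\<close>; this is where
  \<open>exp (- 1 / 2)\<close> and the angle \<open>sqrt 3 / 2\<close> come from. The same series, which have rational terms and
  converge very fast, also give the decimals.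
\<close>

section \<open>Sequences without an increasing triple\<close>

definition no_triple_upto :: "nat \<Rightarrow> (nat \<Rightarrow> real) \<Rightarrow> bool" where
  "no_triple_upto n u \<longleftrightarrow> (\<forall>t\<le>n. \<not> increasing_triple_at u t)"

lemma no_triple_upto_Suc:
  "no_triple_upto (Suc n) u \<longleftrightarrow> no_triple_upto n u \<and> \<not> increasing_triple_at u (Suc n)"
  by (auto simp: no_triple_upto_def le_Suc_eq)

lemma no_triple_upto_mono: "no_triple_upto n u \<Longrightarrow> m \<le> n \<Longrightarrow> no_triple_upto m u"
  by (auto simp: no_triple_upto_def)

lemma no_triple_upto_cong:
  assumes "\<And>i. 1 \<le> i \<Longrightarrow> i \<le> n \<Longrightarrow> u i = v i"
  shows "no_triple_upto n u \<longleftrightarrow> no_triple_upto n v"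
proof -
  have "increasing_triple_at u t \<longleftrightarrow> increasing_triple_at v t" if "t \<le> n" for t
    using that assms[of t] assms[of "t - 1"] assms[of "t - 2"]
    by (cases "3 \<le> t") (simp_all add: increasing_triple_at_def)
  then show ?thesis by (auto simp: no_triple_upto_def)
qed

lemma no_triple_upto_less_3: "n < 3 \<Longrightarrow> no_triple_upto n u"
  by (auto simp: no_triple_upto_def increasing_triple_at_def)

lemma strict_mono_on_extend_left:
  fixes u :: "nat \<Rightarrow> real"
  assumes "strict_mono_on {Suc n<..N} u" and "u (Suc n) < u (Suc (Suc n))" and "n + 2 \<le> N"
  shows "strict_mono_on {n<..N} u"
proof (rule strict_mono_onI)
  fix i j assume ij: "i \<in> {n<..N}" "j \<in> {n<..N}" "i < j"
  show "u i < u j"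
  proof (cases "i = Suc n")
    case True
    have "u (Suc (Suc n)) \<le> u j"
      using strict_mono_onD[OF assms(1), of "Suc (Suc n)" j] ij True
      by (cases "j = Suc (Suc n)") auto
    then show ?thesis using True assms(2) by simp
  next
    case False
    then show ?thesis using ij by (intro strict_mono_onD[OF assms(1)]) auto
  qed
qed

text \<open>Nothing is said about how the value at \<open>n\<close> compares with the value at \<open>n + 1\<close>. The two conditions
  therefore concern disjoint sets of indices and are independent for independent random variables.\<close>

definition ascends_after :: "nat \<Rightarrow> nat \<Rightarrow> (nat \<Rightarrow> real) \<Rightarrow> bool" where
  "ascends_after n N u \<longleftrightarrow> no_triple_upto n u \<and> strict_mono_on {n<..N} u"

text \<open>For \<open>n < N\<close> this is the event that the first triple ends exactly at \<open>n + 1\<close> and that the values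
  keep increasing from there up to \<open>N\<close>. The condition \<open>2 \<le> n\<close> is necessary since truncated subtraction would otherwise identify
  \<open>n - 2\<close> with \<open>0\<close> and admit an increasing run that is too short.\<close>

definition ascends_into :: "nat \<Rightarrow> nat \<Rightarrow> (nat \<Rightarrow> real) \<Rightarrow> bool" where
  "ascends_into n N u \<longleftrightarrow> 2 \<le> n \<and> no_triple_upto n u \<and> strict_mono_on {n - 2<..N} u"

lemma ascends_into_imp_after: "ascends_into n N u \<Longrightarrow> ascends_after n N u"
proof -
  assume a: "ascends_into n N u"
  have "{n<..N} \<subseteq> {n - 2<..N}" by auto
  then have "strict_mono_on {n<..N} u"
    using a monotone_on_subset unfolding ascends_into_def by blast
  then show ?thesis using a by (simp add: ascends_into_def ascends_after_def)
qed

text \<open>A sequence counted by the left-hand side either has no triple at \<open>n + 2\<close> and \<open>n + 3\<close>, or it has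
  one there, which forces \<open>u (n + 1) < u (n + 2)\<close> and so extends the run down to \<open>n + 1\<close>. Conversely, a run
  on \<open>n + 1, \<dots>, N\<close> contains a triple ending at \<open>n + 3\<close>, so the two cases exclude each other; the
  subtracted event is a triple ending at \<open>n + 1\<close>.\<close>

lemma ascends_into_step:
  assumes "n + 3 \<le> N"
  shows "ascends_after (n + 1) N u \<longleftrightarrow>
    ascends_into (n + 3) N u \<or> (ascends_after n N u \<and> \<not> ascends_into n N u)"
    and "\<not> (ascends_into (n + 3) N u \<and> ascends_after n N u)"
proof -
  have triple: "increasing_triple_at u (n + 3)" if "strict_mono_on {n<..N} u"
    using strict_mono_onD[OF that, of "n + 1" "n + 2"] strict_mono_onD[OF that, of "n + 2" "n + 3"] assms
    by (auto simp: increasing_triple_at_def numeral_3_eq_3)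
  then show "\<not> (ascends_into (n + 3) N u \<and> ascends_after n N u)"
    by (auto simp: ascends_into_def ascends_after_def no_triple_upto_def)
  have into3: "ascends_into (n + 3) N u \<longleftrightarrow> no_triple_upto (n + 3) u \<and> strict_mono_on {n + 1<..N} u"
    by (auto simp: ascends_into_def)
  have left: "strict_mono_on {n<..N} u"
    if a: "no_triple_upto (n + 1) u" and b: "strict_mono_on {n + 1<..N} u" and c: "\<not> no_triple_upto (n + 3) u"
  proof -
    have "increasing_triple_at u (n + 2) \<or> increasing_triple_at u (n + 3)"
      using a c by (auto simp: no_triple_upto_Suc numeral_3_eq_3)
    then have "u (n + 1) < u (n + 2)"
      by (auto simp: increasing_triple_at_def numeral_3_eq_3)
    then show ?thesis
      using b assms strict_mono_on_extend_left[of n N u] by simp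
  qed
  have into: "ascends_into n N u \<longleftrightarrow> increasing_triple_at u (n + 1)"
    if a: "no_triple_upto n u" and b: "strict_mono_on {n<..N} u"
  proof
    assume "ascends_into n N u"
    then have n: "2 \<le> n" and s: "strict_mono_on {n - 2<..N} u" by (auto simp: ascends_into_def)
    have "u (n - 1) < u n" "u n < u (n + 1)"
      using n assms by (auto intro!: strict_mono_onD[OF s])
    with n show "increasing_triple_at u (n + 1)"
      by (simp add: increasing_triple_at_def)
  next
    assume t: "increasing_triple_at u (n + 1)"
    then obtain k where k: "n = Suc (Suc k)"
      by (cases n; cases "n - 1") (auto simp: increasing_triple_at_def)
    have "strict_mono_on {Suc k<..N} u"
      using t b assms k strict_mono_on_extend_left[of "Suc k" N u] by (auto simp: increasing_triple_at_def)
    then have "strict_mono_on {k<..N} u"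
      using t assms k strict_mono_on_extend_left[of k N u] by (auto simp: increasing_triple_at_def)
    then show "ascends_into n N u" using a k by (simp add: ascends_into_def)
  qed
  show "ascends_after (n + 1) N u \<longleftrightarrow>
    ascends_into (n + 3) N u \<or> (ascends_after n N u \<and> \<not> ascends_into n N u)"
  proof -
    have m: "strict_mono_on {n<..N} u \<Longrightarrow> strict_mono_on {n + 1<..N} u"
      by (erule monotone_on_subset) auto
    have s: "no_triple_upto (n + 1) u \<longleftrightarrow> no_triple_upto n u \<and> \<not> increasing_triple_at u (n + 1)"
      by (simp add: no_triple_upto_Suc)
    have d: "no_triple_upto (n + 3) u \<Longrightarrow> no_triple_upto (n + 1) u"
      by (erule no_triple_upto_mono) auto
    show ?thesis
      using m s d left into into3 unfolding ascends_after_def by blast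
  qed
qed

lemma first_triple_iff_ascends_into:
  "no_triple_upto n u \<and> \<not> no_triple_upto (n + 1) u \<longleftrightarrow> ascends_into n (n + 1) u"
proof (cases "2 \<le> n")
  case True
  then obtain k where k: "n = k + 2" using le_Suc_ex by (metis add.commute)
  have "{k<..k + 3} = {k + 1, k + 2, k + 3}" by auto
  then have "strict_mono_on {k<..k + 3} u \<longleftrightarrow> u (k + 1) < u (k + 2) \<and> u (k + 2) < u (k + 3)"
    by (auto simp: monotone_on_def)
  then show ?thesis
    unfolding k by (auto simp: ascends_into_def no_triple_upto_Suc increasing_triple_at_def numeral_3_eq_3)
next
  case False
  then show ?thesis using no_triple_upto_less_3[of n u] no_triple_upto_less_3[of "n + 1" u]
    by (auto simp: ascends_into_def)
qed

section \<open>Measurability\<close>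

lemma pred_increasing_triple_at:
  assumes "\<And>i. 1 \<le> i \<Longrightarrow> i \<le> t \<Longrightarrow> f i \<in> borel_measurable N"
  shows "Measurable.pred N (\<lambda>\<omega>. increasing_triple_at (\<lambda>i. f i \<omega>) t)"
proof (cases "3 \<le> t")
  case True
  then have "f (t - 2) \<in> borel_measurable N" "f (t - 1) \<in> borel_measurable N" "f t \<in> borel_measurable N"
    using assms[of "t - 2"] assms[of "t - 1"] assms[of t] by simp_all
  then show ?thesis
    unfolding increasing_triple_at_def
    by (intro pred_intros_logic(3) borel_measurable_less) (simp_all add: True)
qed (simp add: increasing_triple_at_def)

lemma pred_no_triple_upto:
  assumes "\<And>i. 1 \<le> i \<Longrightarrow> i \<le> n \<Longrightarrow> f i \<in> borel_measurable N"
  shows "Measurable.pred N (\<lambda>\<omega>. no_triple_upto n (\<lambda>i. f i \<omega>))"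
proof -
  have "Measurable.pred N (\<lambda>\<omega>. increasing_triple_at (\<lambda>i. f i \<omega>) t)" if "t \<in> {..n}" for t
    using that assms by (intro pred_increasing_triple_at) simp
  then have "Measurable.pred N (\<lambda>\<omega>. \<forall>t\<in>{..n}. \<not> increasing_triple_at (\<lambda>i. f i \<omega>) t)"
    by (intro pred_intros_finite(3) pred_intros_logic(2)) simp_all
  moreover have "no_triple_upto n u \<longleftrightarrow> (\<forall>t\<in>{..n}. \<not> increasing_triple_at u t)" for u
    by (auto simp: no_triple_upto_def)
  ultimately show ?thesis by (simp only:)
qed

lemma pred_strict_mono_on:
  fixes f :: "nat \<Rightarrow> 'b \<Rightarrow> real"
  assumes "finite A" and "\<And>i. i \<in> A \<Longrightarrow> f i \<in> borel_measurable N"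
  shows "Measurable.pred N (\<lambda>\<omega>. strict_mono_on A (\<lambda>i. f i \<omega>))"
proof -
  have "Measurable.pred N (\<lambda>\<omega>. f i \<omega> < f j \<omega>)" if "i \<in> A" "j \<in> A" for i j
    using assms(2)[OF that(1)] assms(2)[OF that(2)] by measurable
  then have "Measurable.pred N (\<lambda>\<omega>. \<forall>i\<in>A. \<forall>j\<in>{j\<in>A. i < j}. f i \<omega> < f j \<omega>)"
    using assms(1) by (intro pred_intros_finite(3)) auto
  moreover have "strict_mono_on A g \<longleftrightarrow> (\<forall>i\<in>A. \<forall>j\<in>{j\<in>A. i < j}. g i < g j)" for g :: "nat \<Rightarrow> real"
    by (auto simp: monotone_on_def)
  ultimately show ?thesis by (simp only:)
qed

section \<open>Increasing runs after a triple-free prefix\<close>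

locale iid_uniform = prob_space M for M :: "'a measure" +
  fixes U :: "nat \<Rightarrow> 'a \<Rightarrow> real"
  assumes indep: "indep_vars (\<lambda>_. borel) U {1..}"
    and uniform: "\<And>i. 1 \<le> i \<Longrightarrow> distr M lborel (U i) = uniform_measure lborel {0..1}"
begin

lemma measurable_U [measurable]: "1 \<le> i \<Longrightarrow> U i \<in> borel_measurable M"
  using indep by (auto simp: indep_vars_def)

lemma distr_U: "1 \<le> i \<Longrightarrow> distr M borel (U i) = uniform_measure lborel {0..1}"
  using uniform[of i] distr_cong[of M M borel lborel "U i" "U i"] by simp

text \<open>Fubini's theorem for the independent pair of the first \<open>m\<close> values and the next one. The condition on \<open>Q\<close>
  says that it reads only the first \<open>m\<close> values.\<close>

lemma emeasure_next:
  assumes [measurable]: "Measurable.pred (PiM {1..m} (\<lambda>_. borel) \<Otimes>\<^sub>M borel) (\<lambda>(f, v). Q f v)"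
    and Q: "\<And>u v. Q (restrict u {1..m}) v = Q u v"
  shows "emeasure M {\<omega> \<in> space M. Q (\<lambda>i. U i \<omega>) (U (Suc m) \<omega>)} =
    (\<integral>\<^sup>+v\<in>{0..1}. emeasure M {\<omega> \<in> space M. Q (\<lambda>i. U i \<omega>) v} \<partial>lborel)"
proof -
  let ?P = "PiM {1..m} (\<lambda>_. borel :: real measure)"
  let ?R = "PiM {Suc m} (\<lambda>_. borel :: real measure)"
  let ?X = "\<lambda>\<omega>. restrict (\<lambda>i. U i \<omega>) {1..m}" and ?Y = "\<lambda>\<omega>. restrict (\<lambda>i. U i \<omega>) {Suc m}"
  have "indep_var ?P ?X ?R ?Y"
    by (intro indep_var_restrict[OF indep]) auto
  then have X [measurable]: "?X \<in> measurable M ?P" and Y [measurable]: "?Y \<in> measurable M ?R"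
    and eq: "distr M ?P ?X \<Otimes>\<^sub>M distr M ?R ?Y = distr M (?P \<Otimes>\<^sub>M ?R) (\<lambda>\<omega>. (?X \<omega>, ?Y \<omega>))"
    by (auto simp: indep_var_distribution_eq)
  interpret X: prob_space "distr M ?P ?X" by (intro prob_space_distr) simp
  interpret Y: prob_space "distr M ?R ?Y" by (intro prob_space_distr) simp
  interpret XY: pair_prob_space "distr M ?P ?X" "distr M ?R ?Y" ..
  have [measurable]: "(\<lambda>g. g (Suc m)) \<in> borel_measurable ?R"
    by (intro measurable_component_singleton) simp
  have Q2 [measurable]: "Measurable.pred (?P \<Otimes>\<^sub>M borel) (\<lambda>x. Q (fst x) (snd x))"
    using assms(1) by (simp add: split_beta')
  have [measurable]: "Measurable.pred (?P \<Otimes>\<^sub>M ?R) (\<lambda>x. Q (fst x) (snd x (Suc m)))"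
    using measurable_compose[OF _ Q2, of "\<lambda>x. (fst x, snd x (Suc m))" "?P \<Otimes>\<^sub>M ?R"] by simp
  let ?A = "{x \<in> space (?P \<Otimes>\<^sub>M ?R). Q (fst x) (snd x (Suc m))}"
  have A [measurable]: "?A \<in> sets (?P \<Otimes>\<^sub>M ?R)" by measurable
  have F [measurable]: "(\<lambda>v. emeasure M {\<omega> \<in> space M. Q (\<lambda>i. U i \<omega>) v}) \<in> borel_measurable borel"
  proof -
    have "Measurable.pred (borel \<Otimes>\<^sub>M M) (\<lambda>x. Q (?X (snd x)) (fst x))"
      using measurable_compose[OF _ Q2, of "\<lambda>x. (?X (snd x), fst x)" "borel \<Otimes>\<^sub>M M"] by simp
    then have "{x \<in> space (borel \<Otimes>\<^sub>M M). Q (?X (snd x)) (fst x)} \<in> sets (borel \<Otimes>\<^sub>M M)"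
      by measurable
    from measurable_emeasure_Pair[OF this] show ?thesis
      by (simp add: space_pair_measure vimage_def Q del: One_nat_def cong: conj_cong)
  qed
  have "{\<omega> \<in> space M. Q (\<lambda>i. U i \<omega>) (U (Suc m) \<omega>)} = (\<lambda>\<omega>. (?X \<omega>, ?Y \<omega>)) -` ?A \<inter> space M"
    using measurable_space[OF X] measurable_space[OF Y] by (auto simp: space_pair_measure Q simp del: One_nat_def)
  then have "emeasure M {\<omega> \<in> space M. Q (\<lambda>i. U i \<omega>) (U (Suc m) \<omega>)} =
      emeasure (distr M (?P \<Otimes>\<^sub>M ?R) (\<lambda>\<omega>. (?X \<omega>, ?Y \<omega>))) ?A"
    using emeasure_distr[OF measurable_Pair[OF X Y] A] by simp
  also have "\<dots> = (\<integral>\<^sup>+g. emeasure (distr M ?P ?X) ((\<lambda>x. (x, g)) -` ?A) \<partial>distr M ?R ?Y)"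
  proof -
    have "?A \<in> sets (distr M ?P ?X \<Otimes>\<^sub>M distr M ?R ?Y)"
      unfolding eq sets_distr by (rule A)
    from XY.emeasure_pair_measure_alt2[OF this] show ?thesis unfolding eq .
  qed
  also have "\<dots> = (\<integral>\<^sup>+g. emeasure M {\<omega> \<in> space M. Q (\<lambda>i. U i \<omega>) (g (Suc m))} \<partial>distr M ?R ?Y)"
  proof (rule nn_integral_cong)
    fix g assume "g \<in> space (distr M ?R ?Y)"
    then have g: "g \<in> space ?R" by simp
    have e: "(\<lambda>x. (x, g)) -` ?A = {f \<in> space ?P. Q f (g (Suc m))}"
      using g by (auto simp: space_pair_measure)
    moreover have "{f \<in> space ?P. Q f (g (Suc m))} \<in> sets ?P"
      using sets_Pair2[OF A, of g] e by simp
    moreover have "?X -` {f \<in> space ?P. Q f (g (Suc m))} \<inter> space M = {\<omega> \<in> space M. Q (\<lambda>i. U i \<omega>) (g (Suc m))}"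
      using measurable_space[OF X] by (auto simp: Q simp del: One_nat_def)
    ultimately show "emeasure (distr M ?P ?X) ((\<lambda>x. (x, g)) -` ?A) =
        emeasure M {\<omega> \<in> space M. Q (\<lambda>i. U i \<omega>) (g (Suc m))}"
      using emeasure_distr[OF X, of "{f \<in> space ?P. Q f (g (Suc m))}"] by simp
  qed
  also have "\<dots> = (\<integral>\<^sup>+v. emeasure M {\<omega> \<in> space M. Q (\<lambda>i. U i \<omega>) v} \<partial>distr M borel (U (Suc m)))"
  proof -
    have "(\<lambda>g. emeasure M {\<omega> \<in> space M. Q (\<lambda>i. U i \<omega>) (g (Suc m))}) \<in> borel_measurable ?R"
      by (rule measurable_compose[OF _ F]) measurable
    then have "(\<integral>\<^sup>+g. emeasure M {\<omega> \<in> space M. Q (\<lambda>i. U i \<omega>) (g (Suc m))} \<partial>distr M ?R ?Y) =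
        (\<integral>\<^sup>+\<omega>'. emeasure M {\<omega> \<in> space M. Q (\<lambda>i. U i \<omega>) (?Y \<omega>' (Suc m))} \<partial>M)"
      by (intro nn_integral_distr Y) simp
    also have "\<dots> = (\<integral>\<^sup>+v. emeasure M {\<omega> \<in> space M. Q (\<lambda>i. U i \<omega>) v} \<partial>distr M borel (U (Suc m)))"
      using F by (subst nn_integral_distr) simp_all
    finally show ?thesis .
  qed
  also have "\<dots> = (\<integral>\<^sup>+v\<in>{0..1}. emeasure M {\<omega> \<in> space M. Q (\<lambda>i. U i \<omega>) v} \<partial>lborel)"
    using F nn_integral_uniform_measure[of "\<lambda>v. emeasure M {\<omega> \<in> space M. Q (\<lambda>i. U i \<omega>) v}" lborel "{0..1}"]
    by (simp add: distr_U divide_ennreal_def)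
  finally show ?thesis .
qed

lemma AE_U: "1 \<le> i \<Longrightarrow> AE \<omega> in M. U i \<omega> \<le> 1"
proof -
  assume i: "1 \<le> i"
  have "AE v in distr M borel (U i). v \<le> 1"
    unfolding distr_U[OF i] by (intro AE_uniform_measureI) auto
  then show ?thesis by (rule AE_distrD[OF measurable_U[OF i]])
qed

lemma sets_no_triple_upto [measurable]:
  "{\<omega> \<in> space M. no_triple_upto n (\<lambda>i. U i \<omega>)} \<in> sets M"
  using pred_no_triple_upto[of n U M] by measurable

definition survival :: "nat \<Rightarrow> real" where
  "survival n = prob {\<omega> \<in> space M. no_triple_upto n (\<lambda>i. U i \<omega>)}"

text \<open>Bounding the run by a number \<open>x\<close> makes induction on its length possible: given its last value \<open>v\<close>,
  the rest is a run bounded by \<open>v\<close>, and \<open>v ^ k / fact k\<close> integrates to the next term. The minimum with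
  \<open>1\<close> lets \<open>x\<close> exceed the range of the variables, where the bound is almost surely no restriction.\<close>

lemma emeasure_ascends_below:
  assumes "0 \<le> x"
  shows "emeasure M {\<omega> \<in> space M. ascends_after n (n + k) (\<lambda>i. U i \<omega>) \<and> (\<forall>i\<in>{n<..n + k}. U i \<omega> < x)}
    = ennreal (survival n * min 1 x ^ k / fact k)"
  using assms
proof (induction k arbitrary: x)
  case 0
  show ?case by (simp add: survival_def ascends_after_def emeasure_eq_measure monotone_on_def)
next
  case (Suc k)
  let ?m = "n + k"
  define Q where "Q f v \<longleftrightarrow> ascends_after n ?m f \<and> (\<forall>i\<in>{n<..?m}. f i < v) \<and> v < x" for f and v :: real
  let ?N = "PiM {1..?m} (\<lambda>_. borel :: real measure) \<Otimes>\<^sub>M (borel :: real measure)"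
  have c [measurable]: "(\<lambda>y. fst y i) \<in> borel_measurable ?N" if "1 \<le> i" "i \<le> ?m" for i
    using that by (intro measurable_compose[OF measurable_fst measurable_component_singleton]) auto
  have "Measurable.pred ?N (\<lambda>y. no_triple_upto n (\<lambda>i. fst y i))"
    by (intro pred_no_triple_upto c) auto
  moreover have "Measurable.pred ?N (\<lambda>y. strict_mono_on {n<..?m} (\<lambda>i. fst y i))"
    by (intro pred_strict_mono_on c) auto
  moreover have "Measurable.pred ?N (\<lambda>y. \<forall>i\<in>{n<..?m}. fst y i < snd y)"
    by (intro pred_intros_finite(3) borel_measurable_less c) auto
  ultimately have meas: "Measurable.pred ?N (\<lambda>(f, v). Q f v)"
    unfolding Q_def ascends_after_def split_beta' by measurable
  have "no_triple_upto n (restrict u {1..?m}) \<longleftrightarrow> no_triple_upto n u" for u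
    by (rule no_triple_upto_cong) auto
  then have dep: "Q (restrict u {1..?m}) v = Q u v" for u v
    by (auto simp: Q_def ascends_after_def monotone_on_def)
  have split: "ascends_after n (n + Suc k) u \<and> (\<forall>i\<in>{n<..n + Suc k}. u i < x) \<longleftrightarrow> Q u (u (Suc ?m))" for u
  proof -
    have "{n<..n + Suc k} = insert (Suc ?m) {n<..?m}" by auto
    then show ?thesis
      by (auto simp: Q_def ascends_after_def monotone_on_def)
  qed
  let ?c = "survival n / fact k"
  have "emeasure M {\<omega> \<in> space M. ascends_after n (n + Suc k) (\<lambda>i. U i \<omega>) \<and> (\<forall>i\<in>{n<..n + Suc k}. U i \<omega> < x)}
      = emeasure M {\<omega> \<in> space M. Q (\<lambda>i. U i \<omega>) (U (Suc ?m) \<omega>)}"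
    using split by simp
  also have "\<dots> = (\<integral>\<^sup>+v\<in>{0..1}. emeasure M {\<omega> \<in> space M. Q (\<lambda>i. U i \<omega>) v} \<partial>lborel)"
    using emeasure_next[where m = ?m and Q = Q, OF meas dep] by simp
  also have "\<dots> = (\<integral>\<^sup>+v. ennreal (?c * v ^ k) * indicator {0..min 1 x} v \<partial>lborel)"
  \<comment> \<open>The integrands may differ at the point \<open>x\<close>, since \<open>Q\<close> asks for \<open>v < x\<close> but the interval is closed.\<close>
  proof (intro nn_integral_cong_AE, rule AE_mp[OF AE_lborel_singleton[of x]], intro AE_I2 impI)
    fix v :: real assume "v \<noteq> x"
    consider "v < x" "0 \<le> v" "v \<le> 1" | "x < v" "0 \<le> v" "v \<le> 1" | "\<not> (0 \<le> v \<and> v \<le> 1)"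
      using \<open>v \<noteq> x\<close> by linarith
    then show "emeasure M {\<omega> \<in> space M. Q (\<lambda>i. U i \<omega>) v} * indicator {0..1} v =
        ennreal (?c * v ^ k) * indicator {0..min 1 x} v"
    proof cases
      case 1
      then have "{\<omega> \<in> space M. Q (\<lambda>i. U i \<omega>) v} =
        {\<omega> \<in> space M. ascends_after n (n + k) (\<lambda>i. U i \<omega>) \<and> (\<forall>i\<in>{n<..n + k}. U i \<omega> < v)}"
        by (auto simp: Q_def)
      with 1 Suc.IH[of v] show ?thesis by (simp add: min_absorb2)
    next
      case 2
      then have "{\<omega> \<in> space M. Q (\<lambda>i. U i \<omega>) v} = {}" by (auto simp: Q_def)
      then have "emeasure M {\<omega> \<in> space M. Q (\<lambda>i. U i \<omega>) v} = 0" by (simp only: emeasure_empty)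
      with 2 show ?thesis by simp
    next
      case 3
      then show ?thesis by (auto simp: indicator_def)
    qed
  qed
  also have "\<dots> = ennreal (survival n * min 1 x ^ Suc k / fact (Suc k) - survival n * 0 ^ Suc k / fact (Suc k))"
  proof (rule nn_integral_FTC_Icc)
    fix v :: real assume "v \<in> {0..min 1 x}"
    have "((\<lambda>v. survival n * v ^ Suc k / fact (Suc k)) has_real_derivative survival n * (real (Suc k) * v ^ k) / fact (Suc k)) (at v)"
      using DERIV_cdivide[OF DERIV_cmult[OF DERIV_pow[of "Suc k" v], of "survival n"], of "fact (Suc k)"]
      by (simp only: diff_Suc_Suc diff_zero)
    moreover have "survival n * (real (Suc k) * v ^ k) / fact (Suc k) = ?c * v ^ k"
      by (simp add: field_simps del: of_nat_Suc)
    ultimately show "((\<lambda>v. survival n * v ^ Suc k / fact (Suc k)) has_real_derivative ?c * v ^ k) (at v)"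
      by (simp only:)
    show "0 \<le> ?c * v ^ k" using \<open>v \<in> {0..min 1 x}\<close> by (simp add: survival_def)
  qed (use Suc.prems in auto)
  finally show ?case by simp
qed

lemma pred_ascends_after [measurable]: "Measurable.pred M (\<lambda>\<omega>. ascends_after n N (\<lambda>i. U i \<omega>))"
  unfolding ascends_after_def
  using pred_no_triple_upto[of n U M] pred_strict_mono_on[of "{n<..N}" U M] by simp measurable

lemma pred_ascends_into [measurable]: "Measurable.pred M (\<lambda>\<omega>. ascends_into n N (\<lambda>i. U i \<omega>))"
  unfolding ascends_into_def
  using pred_no_triple_upto[of n U M] pred_strict_mono_on[of "{n - 2<..N}" U M] by simp measurable

lemma prob_ascends_after:
  assumes "n \<le> N"
  shows "prob {\<omega> \<in> space M. ascends_after n N (\<lambda>i. U i \<omega>)} = survival n / fact (N - n)"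
proof -
  obtain k where N: "N = n + k" using assms le_Suc_ex by blast
  have [measurable]: "Measurable.pred M (\<lambda>\<omega>. \<forall>i\<in>{n<..N}. U i \<omega> < 2)"
    by (intro pred_intros_finite(3)) auto
  \<comment> \<open>Any bound above the range of the variables works here; the value \<open>2\<close> gives a strict inequality even at \<open>1\<close>.\<close>
  have "AE \<omega> in M. \<forall>i\<in>{n<..N}. U i \<omega> \<le> 1"
    by (intro AE_finite_allI AE_U) auto
  then have "AE \<omega> in M. \<forall>i\<in>{n<..N}. U i \<omega> < 2"
    by eventually_elim force
  then have "emeasure M {\<omega> \<in> space M. ascends_after n N (\<lambda>i. U i \<omega>)} =
      emeasure M {\<omega> \<in> space M. ascends_after n N (\<lambda>i. U i \<omega>) \<and> (\<forall>i\<in>{n<..N}. U i \<omega> < 2)}"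
    by (intro emeasure_eq_AE) auto
  also have "\<dots> = ennreal (survival n / fact (N - n))"
    using emeasure_ascends_below[of 2 n k] by (simp add: N)
  finally show ?thesis
    by (simp add: emeasure_eq_measure survival_def)
qed

definition into_prob :: "nat \<Rightarrow> nat \<Rightarrow> real" where
  "into_prob n N = prob {\<omega> \<in> space M. ascends_into n N (\<lambda>i. U i \<omega>)}"

lemma into_prob_step:
  assumes "n + 3 \<le> N"
  shows "into_prob (n + 3) N = survival (n + 1) / fact (N - (n + 1)) - survival n / fact (N - n) + into_prob n N"
proof -
  let ?ev = "\<lambda>P. {\<omega> \<in> space M. P (\<lambda>i. U i \<omega>)}"
  let ?D = "?ev (ascends_after n N) - ?ev (ascends_into n N)"
  have 1: "prob ?D = survival n / fact (N - n) - into_prob n N"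
    unfolding into_prob_def using prob_ascends_after[of n N] assms ascends_into_imp_after
    by (subst finite_measure_Diff) auto
  have "?ev (ascends_after (n + 1) N) = ?ev (ascends_into (n + 3) N) \<union> ?D"
    using ascends_into_step(1)[OF assms] by blast
  then have "prob (?ev (ascends_after (n + 1) N)) = into_prob (n + 3) N + prob ?D"
    unfolding into_prob_def using ascends_into_step(2)[OF assms]
    by (simp only:) (intro finite_measure_Union, auto)
  then show ?thesis using 1 prob_ascends_after[of "n + 1" N] assms by simp
qed

lemma survival_diff: "survival n - survival (n + 1) = into_prob n (n + 1)"
proof -
  let ?ev = "\<lambda>P. {\<omega> \<in> space M. P (\<lambda>i. U i \<omega>)}"
  have "?ev (ascends_into n (n + 1)) = ?ev (no_triple_upto n) - ?ev (no_triple_upto (n + 1))"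
    using first_triple_iff_ascends_into[of n] by blast
  then have "into_prob n (n + 1) = prob (?ev (no_triple_upto n) - ?ev (no_triple_upto (n + 1)))"
    by (simp add: into_prob_def)
  also have "\<dots> = survival n - survival (n + 1)"
    unfolding survival_def by (intro finite_measure_Diff) (auto intro: no_triple_upto_mono)
  finally show ?thesis by simp
qed

lemma into_prob_small: "n < 2 \<Longrightarrow> into_prob n N = 0"
  by (simp add: into_prob_def ascends_into_def)

lemma into_prob_2: "2 < N \<Longrightarrow> into_prob 2 N = survival 0 / fact N"
  using prob_ascends_after[of 0 N]
  by (simp add: into_prob_def ascends_into_def ascends_after_def no_triple_upto_less_3)

lemma survival_0: "survival 0 = 1"
  by (simp add: survival_def no_triple_upto_less_3 prob_space)

text \<open>A triple-free prefix of length \<open>n\<close> is followed by an increasing triple of fresh values in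
  \<open>1 / fact 3\<close> of the cases.\<close>

lemma survival_decay: "survival (n + 3) \<le> 5 / 6 * survival n"
proof -
  let ?ev = "\<lambda>P. {\<omega> \<in> space M. P (\<lambda>i. U i \<omega>)}"
  have "\<not> no_triple_upto (n + 3) u" if "ascends_after n (n + 3) u" for u
  proof -
    have s: "strict_mono_on {n<..n + 3} u" using that by (simp add: ascends_after_def)
    have "increasing_triple_at u (n + 3)"
      using strict_mono_onD[OF s, of "n + 1" "n + 2"] strict_mono_onD[OF s, of "n + 2" "n + 3"]
      by (auto simp: increasing_triple_at_def numeral_3_eq_3)
    then show ?thesis by (auto simp: no_triple_upto_def)
  qed
  then have "?ev (no_triple_upto (n + 3)) \<subseteq> ?ev (no_triple_upto n) - ?ev (ascends_after n (n + 3))"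
    using no_triple_upto_mono[of "n + 3" _ n] by auto
  then have "survival (n + 3) \<le> prob (?ev (no_triple_upto n) - ?ev (ascends_after n (n + 3)))"
    unfolding survival_def by (intro finite_measure_mono) auto
  also have "\<dots> = survival n - survival n / fact 3"
  proof -
    have "?ev (ascends_after n (n + 3)) \<in> events" by measurable
    moreover have "?ev (ascends_after n (n + 3)) \<subseteq> ?ev (no_triple_upto n)"
      by (auto simp: ascends_after_def)
    ultimately show ?thesis
      using prob_ascends_after[of n "n + 3"] by (simp add: finite_measure_Diff survival_def)
  qed
  finally show ?thesis by (simp add: fact_numeral)
qed

end

section \<open>The convolution identity\<close>

text \<open>With these signs, \<open>\<Sum>k. recip_sign k / fact k * x ^ k\<close> is the reciprocal of the generating function of
  the survival probabilities.\<close>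

definition recip_sign :: "nat \<Rightarrow> real" where
  "recip_sign k = (if k mod 3 = 0 then 1 else if k mod 3 = 1 then - 1 else 0)"

definition recip_coeff :: "nat \<Rightarrow> real" where
  "recip_coeff k = recip_sign k / fact k"

lemma recip_sign_add_3: "recip_sign (k + 3) = recip_sign k"
  by (simp add: recip_sign_def)

context iid_uniform
begin

text \<open>Iterating \<open>into_prob_step\<close> contributes the indices \<open>n - 2, n - 5, \<dots>\<close> with a plus sign and the indices
  \<open>n - 3, n - 6, \<dots>\<close> with a minus sign.\<close>

lemma into_prob_eq_sum: "n < N \<Longrightarrow> into_prob n N = (\<Sum>i<n. recip_sign (n + 1 - i) * (survival i / fact (N - i)))"
proof (induction n rule: less_induct)
  case (less n)
  show ?case
  proof (cases "3 \<le> n")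
    case True
    then obtain m where n: "n = m + 3" using le_Suc_ex by (metis add.commute)
    have "recip_sign (n + 1 - i) = recip_sign (m + 1 - i)" if "i < m" for i
    proof -
      have "n + 1 - i = (m + 1 - i) + 3" using that n by simp
      then show ?thesis by (simp only: recip_sign_add_3)
    qed
    then have "(\<Sum>i<n. recip_sign (n + 1 - i) * (survival i / fact (N - i))) =
      (\<Sum>i<m. recip_sign (m + 1 - i) * (survival i / fact (N - i)))
      + recip_sign 4 * (survival m / fact (N - m)) + recip_sign 3 * (survival (m + 1) / fact (N - (m + 1)))
      + recip_sign 2 * (survival (m + 2) / fact (N - (m + 2)))"
      by (simp add: n numeral_3_eq_3 numeral_2_eq_2 eval_nat_numeral)
    also have "\<dots> = into_prob n N"
      using into_prob_step[of m N] less n by (simp add: recip_sign_def)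
    finally show ?thesis by simp
  next
    case False
    then consider "n = 0" | "n = 1" | "n = 2" by linarith
    then show ?thesis
      using less.prems into_prob_2[of N] by cases (simp_all add: into_prob_small into_prob_2 recip_sign_def numeral_2_eq_2)
  qed
qed

text \<open>For \<open>N = n + 1\<close> the terms with \<open>i < n\<close> form the probability that the first triple ends at \<open>n + 1\<close>,
  and the last two terms are \<open>- survival n + survival (n + 1)\<close>.\<close>

lemma survival_convolution: "(\<Sum>i\<le>N. survival i * recip_coeff (N - i)) = (if N = 0 then 1 else 0)"
proof (cases N)
  case 0
  then show ?thesis by (simp add: survival_0 recip_coeff_def recip_sign_def)
next
  case (Suc n)
  have "(\<Sum>i\<le>N. survival i * recip_coeff (N - i)) = (\<Sum>i<n. survival i * recip_coeff (N - i)) - survival n + survival (n + 1)"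
    by (simp add: Suc lessThan_Suc_atMost[symmetric] recip_coeff_def recip_sign_def)
  also have "(\<Sum>i<n. survival i * recip_coeff (N - i)) = into_prob n (n + 1)"
    by (simp add: into_prob_eq_sum Suc recip_coeff_def mult.commute)
  finally show ?thesis using survival_diff[of n] Suc by simp
qed

lemma survival_bounds: "0 \<le> survival n" "survival n \<le> 1"
  by (simp_all add: survival_def)

text \<open>The ratio \<open>19 / 20\<close> is a rational number whose cube exceeds the decay factor \<open>5 / 6\<close> over three
  steps; the factor \<open>2\<close> covers the first three indices.\<close>

lemma survival_le_geometric: "survival n \<le> 2 * (19 / 20) ^ n"
proof (induction n rule: less_induct)
  case (less n)
  show ?case
  proof (cases "3 \<le> n")
    case True
    then obtain m where n: "n = m + 3" using le_Suc_ex by (metis add.commute)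
    have "survival n \<le> 5 / 6 * survival m" using survival_decay[of m] n by simp
    also have "\<dots> \<le> (19 / 20) ^ 3 * (2 * (19 / 20) ^ m)"
      using less.IH[of m] n survival_bounds(1)[of m] by (intro mult_mono) (auto simp: power3_eq_cube)
    also have "\<dots> = 2 * (19 / 20) ^ n" by (simp add: n power_add)
    finally show ?thesis .
  next
    case False
    then consider "n = 0" | "n = 1" | "n = 2" by linarith
    then have "1 \<le> 2 * (19 / 20 :: real) ^ n" by cases (auto simp: power2_eq_square)
    then show ?thesis using survival_bounds(2)[of n] by linarith
  qed
qed

lemma summable_Suc_survival: "summable (\<lambda>n. real (Suc n) * survival n)"
proof (rule summable_comparison_test)
  show "summable (\<lambda>n. 2 * (real (Suc n) * (19 / 20) ^ n))"
    using geometric_deriv_sums[of "19 / 20 :: real"] by (intro summable_mult) (auto simp: sums_iff)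
  have "real (Suc n) * survival n \<le> 2 * (real (Suc n) * (19 / 20) ^ n)" for n
    using mult_left_mono[OF survival_le_geometric[of n], of "real (Suc n)"] by simp
  then show "\<exists>N. \<forall>n\<ge>N. norm (real (Suc n) * survival n) \<le> 2 * (real (Suc n) * (19 / 20) ^ n)"
    using survival_bounds(1) by (auto simp: abs_mult)
qed

end

section \<open>The reciprocal series at 1\<close>

lemma abs_recip_sign: "\<bar>recip_sign k\<bar> \<le> 1"
  by (simp add: recip_sign_def)

lemma abs_recip_coeff: "\<bar>recip_coeff k\<bar> \<le> 1 / fact k"
  using abs_recip_sign[of k] by (simp add: recip_coeff_def abs_div divide_right_mono)

lemma Suc_recip_coeff: "real (Suc k) * recip_coeff (Suc k) = recip_sign (Suc k) / fact k"
  by (simp add: recip_coeff_def)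

lemma summable_inverse_fact: "summable (\<lambda>k. 1 / fact k :: real)"
  using summable_exp[of 1] by (simp add: inverse_eq_divide)

lemma summable_recip_coeff: "summable (\<lambda>k. norm (recip_coeff k))"
  by (rule summable_comparison_test[OF _ summable_inverse_fact]) (use abs_recip_coeff in auto)

lemma summable_recip_coeff_deriv: "summable (\<lambda>k. norm (real k * recip_coeff k))"
proof -
  have "summable (\<lambda>k. norm (real (Suc k) * recip_coeff (Suc k)))"
    unfolding Suc_recip_coeff
    by (rule summable_comparison_test[OF _ summable_inverse_fact])
      (use abs_recip_sign in \<open>auto simp: divide_right_mono\<close>)
  then show ?thesis
    using summable_Suc_iff[of "\<lambda>k. norm (real k * recip_coeff k)"] by blast
qed

text \<open>A real sequence of period \<open>3\<close> with sum \<open>0\<close> over a period is the real part of a geometric sequence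
  whose ratio is a primitive cube root of unity; the first factor is fitted to the values at \<open>0\<close> and \<open>1\<close>.\<close>

lemma recip_sign_eq_Re:
  "recip_sign k = Re (Complex 1 (1 / sqrt 3) * Complex (- 1 / 2) (sqrt 3 / 2) ^ k)"
proof (induction k rule: less_induct)
  case (less k)
  show ?case
  proof (cases "3 \<le> k")
    case True
    then obtain m where k: "k = m + 3" using le_Suc_ex by (metis add.commute)
    have "Complex (- 1 / 2) (sqrt 3 / 2) ^ 3 = 1"
      by (simp add: power3_eq_cube complex_eq_iff)
    then show ?thesis
      using less.IH[of m] by (simp add: k recip_sign_add_3 power_add)
  next
    case False
    then consider "k = 0" | "k = 1" | "k = 2" by linarith
    then show ?thesis
      by cases (simp_all add: recip_sign_def power2_eq_square)
  qed
qed

lemma Re_exp_series_sums: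
  "(\<lambda>k. Re (a * z ^ k) / fact k) sums Re (a * exp z)"
proof -
  have "(\<lambda>k. a * (z ^ k /\<^sub>R fact k)) sums (a * exp z)"
    by (intro sums_mult exp_converges)
  then have "(\<lambda>k. Re (a * (z ^ k /\<^sub>R fact k))) sums Re (a * exp z)"
    by (rule sums_Re)
  then show ?thesis by (simp add: divide_inverse mult.commute)
qed

lemma exp_cube_root: "exp (Complex (- 1 / 2) (sqrt 3 / 2)) =
    of_real (exp (- 1 / 2)) * Complex (cos (sqrt 3 / 2)) (sin (sqrt 3 / 2))"
  by (simp add: exp_eq_polar cis.code)

lemma recip_coeff_sums:
  "recip_coeff sums (exp (- 1 / 2) * (cos (sqrt 3 / 2) - sin (sqrt 3 / 2) / sqrt 3))"
proof -
  let ?a = "Complex 1 (1 / sqrt 3)" and ?w = "Complex (- 1 / 2) (sqrt 3 / 2)"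
  have "recip_coeff sums Re (?a * exp ?w)"
    using Re_exp_series_sums[of ?a ?w] by (simp only: recip_coeff_def[abs_def] recip_sign_eq_Re)
  then show ?thesis by (simp only: exp_cube_root) (simp add: algebra_simps)
qed

lemma recip_coeff_deriv_sums:
  "(\<lambda>k. real k * recip_coeff k) sums (- exp (- 1 / 2) * (cos (sqrt 3 / 2) + sin (sqrt 3 / 2) / sqrt 3))"
proof -
  let ?a = "Complex 1 (1 / sqrt 3)" and ?w = "Complex (- 1 / 2) (sqrt 3 / 2)"
  have "real (Suc k) * recip_coeff (Suc k) = Re (?a * ?w * ?w ^ k) / fact k" for k
    by (simp only: Suc_recip_coeff recip_sign_eq_Re power_Suc mult.assoc)
  moreover have "?a * ?w = Complex (- 1) (1 / sqrt 3)"
    by (simp add: complex_eq_iff field_simps)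
  ultimately have "(\<lambda>k. real (Suc k) * recip_coeff (Suc k)) sums Re (Complex (- 1) (1 / sqrt 3) * exp ?w)"
    using Re_exp_series_sums[of "?a * ?w" ?w] by (simp only:)
  then have "(\<lambda>k. real k * recip_coeff k) sums (Re (Complex (- 1) (1 / sqrt 3) * exp ?w) + real 0 * recip_coeff 0)"
    by (rule sums_Suc[where f = "\<lambda>k. real k * recip_coeff k"])
  then show ?thesis by (simp only: exp_cube_root) (simp add: algebra_simps)
qed

text \<open>The identities \<open>A * C = 1\<close> and \<open>A' * C + A * C' = 0\<close> at \<open>1\<close> for the generating functions \<open>A\<close> and \<open>C\<close>
  of \<open>a\<close> and \<open>c\<close>. The second is the Leibniz rule at the level of coefficients, where the factor \<open>N\<close> is split as
  \<open>i + (N - i)\<close>, so that no differentiation of power series is involved.\<close>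

lemma reciprocal_series_at_1:
  fixes a c :: "nat \<Rightarrow> real"
  assumes conv: "\<And>N. (\<Sum>i\<le>N. a i * c (N - i)) = (if N = 0 then 1 else 0)"
    and a: "summable (\<lambda>n. norm (a n))" "summable (\<lambda>n. norm (real n * a n))"
    and c: "summable (\<lambda>n. norm (c n))" "summable (\<lambda>n. norm (real n * c n))"
  shows "(\<Sum>n. a n) * (\<Sum>n. c n) = 1"
    and "(\<Sum>n. real n * a n) * (\<Sum>n. c n) + (\<Sum>n. a n) * (\<Sum>n. real n * c n) = 0"
proof -
  have "(\<lambda>N. if N = 0 then 1 else 0) sums ((\<Sum>n. a n) * (\<Sum>n. c n))"
    using Cauchy_product_sums[OF a(1) c(1)] by (simp only: conv)
  then show "(\<Sum>n. a n) * (\<Sum>n. c n) = 1"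
    using sums_single[of 0 "\<lambda>_. 1::real"] by (metis (no_types, lifting) sums_unique2)
  have "(\<Sum>i\<le>N. real i * a i * c (N - i)) + (\<Sum>i\<le>N. a i * (real (N - i) * c (N - i))) =
      real N * (\<Sum>i\<le>N. a i * c (N - i))" for N
    unfolding sum.distrib[symmetric] sum_distrib_left
    by (intro sum.cong) (auto simp: algebra_simps)
  then have "(\<Sum>i\<le>N. real i * a i * c (N - i)) + (\<Sum>i\<le>N. a i * (real (N - i) * c (N - i))) = 0" for N
    by (simp add: conv)
  then have "(\<lambda>N. 0::real) sums ((\<Sum>n. real n * a n) * (\<Sum>n. c n) + (\<Sum>n. a n) * (\<Sum>n. real n * c n))"
    using sums_add[OF Cauchy_product_sums[OF a(2) c(1)] Cauchy_product_sums[OF a(1) c(2)]] by (simp only:)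
  then show "(\<Sum>n. real n * a n) * (\<Sum>n. c n) + (\<Sum>n. a n) * (\<Sum>n. real n * c n) = 0"
    using sums_unique2 sums_zero by blast
qed

section \<open>Moments of the waiting time\<close>

lemma no_triple_upto_iff_less_first:
  assumes "\<exists>t. increasing_triple_at u t"
  shows "no_triple_upto n u \<longleftrightarrow> n < first_increasing_triple u"
proof -
  have L: "increasing_triple_at u (first_increasing_triple u)"
    unfolding first_increasing_triple_def using assms by (rule LeastI_ex)
  show ?thesis
  proof
    assume "no_triple_upto n u"
    with L show "n < first_increasing_triple u"
      by (auto simp: no_triple_upto_def not_le[symmetric])
  next
    assume "n < first_increasing_triple u"
    then show "no_triple_upto n u"
      unfolding no_triple_upto_def first_increasing_triple_def by (meson not_less_Least le_less_trans)
  qed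
qed

lemma sum_odd_real: "(\<Sum>n<m. 2 * real n + 1) = (real m)\<^sup>2"
  by (induction m) (auto simp: power2_eq_square algebra_simps)

context iid_uniform
begin

lemma summable_survival: "summable survival"
proof (rule summable_comparison_test[OF _ summable_Suc_survival])
  show "\<exists>N. \<forall>n\<ge>N. norm (survival n) \<le> real (Suc n) * survival n"
    using survival_bounds(1) by (auto simp: algebra_simps)
qed

lemma summable_mult_survival: "summable (\<lambda>n. real n * survival n)"
proof (rule summable_comparison_test[OF _ summable_Suc_survival])
  show "\<exists>N. \<forall>n\<ge>N. norm (real n * survival n) \<le> real (Suc n) * survival n"
    using survival_bounds(1) by (auto simp: algebra_simps)
qed

lemma AE_increasing_triple: "AE \<omega> in M. \<exists>t. increasing_triple_at (\<lambda>i. U i \<omega>) t"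
proof -
  let ?B = "{\<omega> \<in> space M. \<forall>n. no_triple_upto n (\<lambda>i. U i \<omega>)}"
  have B: "?B \<in> events"
    using sets_no_triple_upto by (intro sets.sets_Collect_countable_All) auto
  have "prob ?B \<le> survival n" for n
    unfolding survival_def by (intro finite_measure_mono sets_no_triple_upto) auto
  then have "prob ?B \<le> 0"
    using summable_LIMSEQ_zero[OF summable_survival] by (intro LIMSEQ_le_const) auto
  then have "prob ?B = 0" by (simp add: measure_le_0_iff)
  then have "AE \<omega> in M. \<not> (\<forall>n. no_triple_upto n (\<lambda>i. U i \<omega>))"
    using prob_Collect_eq_0[OF B] by blast
  then show ?thesis
    by eventually_elim (auto simp: no_triple_upto_def)
qed

abbreviation waiting_time :: "'a \<Rightarrow> nat" where
  "waiting_time \<omega> \<equiv> first_increasing_triple (\<lambda>i. U i \<omega>)"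

lemma measurable_waiting_time: "waiting_time \<in> measurable M (count_space UNIV)"
  unfolding first_increasing_triple_def
  by (intro measurable_Least pred_increasing_triple_at measurable_U)

text \<open>A sum up to the waiting time is the sum of \<open>w n\<close> over those \<open>n\<close> for which there is no triple up to
  \<open>n\<close>. Exchanging series and expectation turns each indicator into \<open>survival n\<close>. The weights \<open>1\<close> and
  \<open>2 * n + 1\<close> yield the first two moments.\<close>

lemma expectation_sum_upto_waiting_time:
  fixes w :: "nat \<Rightarrow> real"
  assumes w: "\<And>n. 0 \<le> w n" and s: "summable (\<lambda>n. w n * survival n)"
  shows "integrable M (\<lambda>\<omega>. \<Sum>n<waiting_time \<omega>. w n)"
    and "expectation (\<lambda>\<omega>. \<Sum>n<waiting_time \<omega>. w n) = (\<Sum>n. w n * survival n)"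
proof -
  let ?A = "\<lambda>n. {\<omega> \<in> space M. no_triple_upto n (\<lambda>i. U i \<omega>)}"
  let ?f = "\<lambda>n \<omega>. w n * indicator (?A n) \<omega>"
  have int: "integrable M (?f n)" for n
    by (intro integrable_mult_right integrable_real_indicator sets_no_triple_upto) (simp add: less_top[symmetric])
  have integral: "integral\<^sup>L M (?f n) = w n * survival n" for n
    using sets_no_triple_upto[of n] by (simp add: survival_def)
  have sums: "AE \<omega> in M. (\<lambda>n. ?f n \<omega>) sums (\<Sum>n<waiting_time \<omega>. w n)"
    using AE_increasing_triple AE_space
  proof eventually_elim
    case (elim \<omega>)
    have "(\<lambda>n. ?f n \<omega>) sums (\<Sum>n<waiting_time \<omega>. ?f n \<omega>)"
      using elim by (intro sums_finite) (auto simp: no_triple_upto_iff_less_first indicator_def)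
    also have "(\<Sum>n<waiting_time \<omega>. ?f n \<omega>) = (\<Sum>n<waiting_time \<omega>. w n)"
      using elim by (intro sum.cong) (auto simp: no_triple_upto_iff_less_first indicator_def)
    finally show ?case .
  qed
  have norm_f: "norm (?f n \<omega>) = ?f n \<omega>" for n \<omega>
    using w by (simp add: indicator_def)
  have summable: "AE \<omega> in M. summable (\<lambda>n. norm (?f n \<omega>))"
    using sums unfolding norm_f by eventually_elim (rule sums_summable)
  have summable': "summable (\<lambda>n. \<integral>\<omega>. norm (?f n \<omega>) \<partial>M)"
    unfolding norm_f integral by (rule s)
  have eq: "AE \<omega> in M. (\<Sum>n. ?f n \<omega>) = (\<Sum>n<waiting_time \<omega>. w n)"
    using sums by eventually_elim (simp add: sums_iff)
  have meas: "(\<lambda>\<omega>. \<Sum>n<waiting_time \<omega>. w n) \<in> borel_measurable M"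
    by (rule measurable_compose[OF measurable_waiting_time]) simp
  have int_sum: "integrable M (\<lambda>\<omega>. \<Sum>n. ?f n \<omega>)"
    by (rule integrable_suminf[OF int summable summable'])
  show "integrable M (\<lambda>\<omega>. \<Sum>n<waiting_time \<omega>. w n)"
    by (rule integrable_cong_AE_imp[OF int_sum meas]) (use eq in eventually_elim, simp)
  have "expectation (\<lambda>\<omega>. \<Sum>n<waiting_time \<omega>. w n) = expectation (\<lambda>\<omega>. \<Sum>n. ?f n \<omega>)"
    by (rule integral_cong_AE[OF meas borel_measurable_integrable[OF int_sum]]) (use eq in eventually_elim, simp)
  also have "\<dots> = (\<Sum>n. w n * survival n)"
    using integral_suminf[OF int summable summable'] unfolding integral .
  finally show "expectation (\<lambda>\<omega>. \<Sum>n<waiting_time \<omega>. w n) = (\<Sum>n. w n * survival n)" .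
qed

lemma moments:
  shows "integrable M (\<lambda>\<omega>. real (waiting_time \<omega>))" "expectation (\<lambda>\<omega>. real (waiting_time \<omega>)) = (\<Sum>n. survival n)"
    and "integrable M (\<lambda>\<omega>. (real (waiting_time \<omega>))\<^sup>2)"
    and "expectation (\<lambda>\<omega>. (real (waiting_time \<omega>))\<^sup>2) = 2 * (\<Sum>n. real n * survival n) + (\<Sum>n. survival n)"
proof -
  show "integrable M (\<lambda>\<omega>. real (waiting_time \<omega>))" "expectation (\<lambda>\<omega>. real (waiting_time \<omega>)) = (\<Sum>n. survival n)"
    using expectation_sum_upto_waiting_time[of "\<lambda>_. 1"] summable_survival by simp_all
  have "(\<lambda>n. 2 * (real n * survival n) + survival n) sums (2 * (\<Sum>n. real n * survival n) + (\<Sum>n. survival n))"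
    using summable_mult_survival summable_survival by (intro sums_add sums_mult summable_sums)
  then have s: "(\<lambda>n. (2 * real n + 1) * survival n) sums (2 * (\<Sum>n. real n * survival n) + (\<Sum>n. survival n))"
    by (simp add: algebra_simps)
  then show "integrable M (\<lambda>\<omega>. (real (waiting_time \<omega>))\<^sup>2)"
    and "expectation (\<lambda>\<omega>. (real (waiting_time \<omega>))\<^sup>2) = 2 * (\<Sum>n. real n * survival n) + (\<Sum>n. survival n)"
    using expectation_sum_upto_waiting_time[of "\<lambda>n. 2 * real n + 1"] unfolding sum_odd_real
    by (simp_all add: sums_iff)
qed

text \<open>With the values \<open>D\<close> and \<open>- E\<close> at \<open>1\<close> of the reciprocal function and of its derivative, the generating
  function of the survival probabilities takes the value \<open>1 / D\<close> and has the derivative \<open>E / D\<^sup>2\<close>.\<close>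

lemma mean_and_variance:
  assumes D: "recip_coeff sums D" and E: "(\<lambda>k. real k * recip_coeff k) sums (- E)"
  shows "D \<noteq> 0" "expectation (\<lambda>\<omega>. real (waiting_time \<omega>)) = 1 / D"
    and "variance (\<lambda>\<omega>. real (waiting_time \<omega>)) = (D + 2 * E - 1) / D\<^sup>2"
proof -
  let ?P = "\<Sum>n. survival n" and ?Q = "\<Sum>n. real n * survival n"
  have abs: "summable (\<lambda>n. norm (survival n))" "summable (\<lambda>n. norm (real n * survival n))"
    using summable_survival summable_mult_survival survival_bounds(1) by (simp_all add: abs_mult)
  have 1: "?P * D = 1" and 2: "?Q * D + ?P * (- E) = 0"
    using reciprocal_series_at_1[OF survival_convolution abs summable_recip_coeff summable_recip_coeff_deriv] D E
    by (simp_all add: sums_iff)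
  show D0: "D \<noteq> 0" using 1 by auto
  have P: "?P = 1 / D" using 1 D0 by (simp add: field_simps)
  have Q: "?Q = E / D\<^sup>2" using 2 D0 unfolding P by (simp add: field_simps power2_eq_square)
  show "expectation (\<lambda>\<omega>. real (waiting_time \<omega>)) = 1 / D" using moments(2) P by simp
  have "variance (\<lambda>\<omega>. real (waiting_time \<omega>)) = 2 * ?Q + ?P - ?P\<^sup>2"
    using variance_eq[OF moments(1,3)] moments(2,4) by simp
  also have "\<dots> = (D + 2 * E - 1) / D\<^sup>2"
    unfolding P Q using D0 by (simp add: field_simps power2_eq_square)
  finally show "variance (\<lambda>\<omega>. real (waiting_time \<omega>)) = (D + 2 * E - 1) / D\<^sup>2" .
qed

end

section \<open>Decimal values\<close>

text \<open>The tail is at most \<open>1 / fact m\<close> times a geometric series with ratio \<open>1 / 2\<close>, because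
  \<open>fact m * 2 ^ k \<le> fact (k + m)\<close>.\<close>

lemma abs_suminf_tail_le:
  fixes f :: "nat \<Rightarrow> real"
  assumes f: "\<And>k. \<bar>f k\<bar> \<le> 1 / fact k" and m: "0 < m" and S: "f sums S"
  shows "\<bar>S - (\<Sum>k<m. f k)\<bar> \<le> 2 / fact m"
proof -
  have fact: "fact m * 2 ^ k \<le> (fact (k + m) :: real)" for k
  proof (induction k)
    case (Suc k)
    have "fact m * 2 ^ Suc k = 2 * (fact m * 2 ^ k :: real)" by simp
    also have "\<dots> \<le> real (Suc (k + m)) * fact (k + m)"
      using m Suc by (intro mult_mono) auto
    finally show ?case by simp
  qed simp
  have g: "(\<lambda>k. 1 / fact m * (1 / 2) ^ k) sums (1 / fact m * (1 / (1 - 1 / 2)) :: real)"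
    by (intro sums_mult geometric_sums) simp
  have bound: "norm (f (k + m)) \<le> 1 / fact m * (1 / 2) ^ k" for k
  proof -
    have "norm (f (k + m)) \<le> 1 / fact (k + m)" using f by simp
    also have "\<dots> \<le> 1 / (fact m * 2 ^ k)" using fact by (intro divide_left_mono) auto
    finally show ?thesis by (simp add: power_divide)
  qed
  have "(\<lambda>k. f (k + m)) sums (S - (\<Sum>k<m. f k))"
    using S by (simp add: sums_iff_shift)
  then have "\<bar>S - (\<Sum>k<m. f k)\<bar> = norm (\<Sum>k. f (k + m))" by (simp add: sums_iff)
  also have "\<dots> \<le> (\<Sum>k. 1 / fact m * (1 / 2) ^ k)"
    using g bound by (intro norm_suminf_le) (auto simp: sums_iff)
  also have "\<dots> = 2 / fact m" using g by (simp add: sums_iff)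
  finally show ?thesis .
qed

text \<open>Twenty terms suffice, because \<open>2 / fact 20\<close> is less than \<open>1 / 10 ^ 18\<close>. The numerators, here and for
  the derivative, are the first eighteen decimals of the partial sums.\<close>

lemma recip_series_approx:
  assumes "recip_coeff sums D"
  shows "\<bar>D - 126192958277008679 / 10 ^ 18\<bar> \<le> 2 / 10 ^ 18"
proof -
  have "\<bar>D - (\<Sum>k<20. recip_coeff k)\<bar> \<le> 2 / fact 20"
    using assms abs_recip_coeff by (intro abs_suminf_tail_le) auto
  moreover have "\<bar>(\<Sum>k<20. recip_coeff k) - 126192958277008679 / 10 ^ 18\<bar> \<le> 1 / 10 ^ 18"
    by (simp add: lessThan_nat_numeral lessThan_Suc recip_coeff_def recip_sign_def fact_numeral)
  moreover have "2 / fact 20 \<le> (1 / 10 ^ 18 :: real)"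
    by (simp add: fact_numeral)
  ultimately show ?thesis by linarith
qed

lemma recip_deriv_series_approx:
  assumes "(\<lambda>k. real k * recip_coeff k) sums (- E)"
  shows "\<bar>E - 659700153391701662 / 10 ^ 18\<bar> \<le> 2 / 10 ^ 18"
proof -
  have "(\<lambda>k. - (recip_sign (Suc k) / fact k)) sums E"
    using sums_minus[of "\<lambda>k. recip_sign (Suc k) / fact k" "- E"]
      sums_Suc_iff[of "\<lambda>k. real k * recip_coeff k" "- E"] assms
    unfolding Suc_recip_coeff by simp
  then have "\<bar>E - (\<Sum>k<20. - (recip_sign (Suc k) / fact k))\<bar> \<le> 2 / fact 20"
    using abs_recip_sign by (intro abs_suminf_tail_le) (auto simp: divide_right_mono)
  moreover have "\<bar>(\<Sum>k<20. - (recip_sign (Suc k) / fact k)) - 659700153391701662 / 10 ^ 18\<bar> \<le> 1 / 10 ^ 18"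
    by (simp add: lessThan_nat_numeral lessThan_Suc recip_sign_def fact_numeral)
  moreover have "2 / fact 20 \<le> (1 / 10 ^ 18 :: real)"
    by (simp add: fact_numeral)
  ultimately show ?thesis by linarith
qed

text \<open>The bounds on \<open>D\<close> and \<open>E\<close> are much finer than the ten decimals wanted for the quotients, so it is enough to
  replace \<open>D\<close> and \<open>E\<close> by the endpoints of their intervals.\<close>

lemma moment_bounds:
  fixes D E :: real
  assumes "\<bar>D - 126192958277008679 / 10 ^ 18\<bar> \<le> 2 / 10 ^ 18"
    and "\<bar>E - 659700153391701662 / 10 ^ 18\<bar> \<le> 2 / 10 ^ 18"
  shows "7.9243724345 \<le> 1 / D" "1 / D < 7.9243724346"
    and "27.9813314059 \<le> (D + 2 * E - 1) / D\<^sup>2" "(D + 2 * E - 1) / D\<^sup>2 < 27.9813314060"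
proof -
  let ?l = "0.126192958277008677 :: real" and ?u = "0.126192958277008681 :: real"
  have D: "?l \<le> D" "D \<le> ?u" and E: "0.659700153391701660 \<le> E" "E \<le> 0.659700153391701664"
    using assms unfolding abs_diff_le_iff by simp_all
  have pos: "0 < D" using D by simp
  show "7.9243724345 \<le> 1 / D" "1 / D < 7.9243724346"
    using D pos by (simp_all add: field_simps)
  have sq: "?l\<^sup>2 \<le> D\<^sup>2" "D\<^sup>2 \<le> ?u\<^sup>2"
    using D pos by (intro power_mono; simp)+
  have "27.9813314059 * D\<^sup>2 \<le> 27.9813314059 * ?u\<^sup>2" using sq by simp
  also have "\<dots> \<le> D + 2 * E - 1" using D E by (simp add: power2_eq_square)
  finally show "27.9813314059 \<le> (D + 2 * E - 1) / D\<^sup>2" using pos by (simp add: pos_le_divide_eq)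
  have "D + 2 * E - 1 < 27.9813314060 * ?l\<^sup>2" using D E by (simp add: power2_eq_square)
  also have "\<dots> \<le> 27.9813314060 * D\<^sup>2" using sq by simp
  finally show "(D + 2 * E - 1) / D\<^sup>2 < 27.9813314060" using pos by (simp add: pos_divide_less_eq)
qed

section \<open>Mean and variance in closed form\<close>

theorem corollary3p9:
  fixes M :: "'a measure" and U :: "nat \<Rightarrow> 'a \<Rightarrow> real"
    and T :: "'a \<Rightarrow> real" and S C :: real
  assumes "prob_space M"
    and "prob_space.indep_vars M (\<lambda>_. borel) U {1..}"
    and "\<And>i. i \<ge> 1 \<Longrightarrow> distr M lborel (U i) = uniform_measure lborel {0..1}"
  defines "T \<equiv> \<lambda>\<omega>. real (first_increasing_triple (\<lambda>i. U i \<omega>))"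
    and "S \<equiv> sin (sqrt 3 / 2)"
    and "C \<equiv> cos (sqrt 3 / 2)"
  shows "(AE \<omega> in M. \<exists>t. increasing_triple_at (\<lambda>i. U i \<omega>) t)
    \<and> integrable M T
    \<and> integrable M (\<lambda>\<omega>. (T \<omega>)\<^sup>2)
    \<and> prob_space.expectation M T = sqrt (3 * exp 1) / (sqrt 3 * C - S)
    \<and> prob_space.variance M T =
        (9 * sqrt (exp 1) * C + sqrt (3 * exp 1) * S - 3 * exp 1) / (sqrt 3 * C - S)\<^sup>2
    \<and> 7.9243724345 \<le> prob_space.expectation M T
    \<and> prob_space.expectation M T < 7.9243724346
    \<and> 27.9813314059 \<le> prob_space.variance M T
    \<and> prob_space.variance M T < 27.9813314060"
proof -
  interpret prob_space M by fact
  interpret iid_uniform M U by unfold_locales fact+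
  define e where "e = exp (1 / 2 :: real)"
  define D where "D = exp (- 1 / 2) * (C - S / sqrt 3)"
  define E where "E = exp (- 1 / 2) * (C + S / sqrt 3)"
  have D: "recip_coeff sums D"
    using recip_coeff_sums by (simp add: D_def C_def S_def)
  have E: "(\<lambda>k. real k * recip_coeff k) sums (- E)"
    using recip_coeff_deriv_sums by (simp add: E_def C_def S_def)
  note mv = mean_and_variance[OF D E]
  have e: "0 < e" "exp 1 = e\<^sup>2" "exp (- 1 / 2) = 1 / e"
    by (simp_all add: e_def exp_minus inverse_eq_divide flip: exp_double)
  have roots: "sqrt (exp 1) = e" "sqrt (3 * exp 1) = sqrt 3 * e"
    using e by (simp_all add: real_sqrt_mult)
  have Deq: "sqrt 3 * C - S = sqrt 3 * e * D" and Eeq: "sqrt 3 * C + S = sqrt 3 * e * E"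
    unfolding D_def E_def e(3) using e(1) by (simp_all add: field_simps)
  have mean: "1 / D = sqrt (3 * exp 1) / (sqrt 3 * C - S)"
    unfolding roots Deq using e(1) mv(1) by (simp add: field_simps)
  have "9 * sqrt (exp 1) * C + sqrt (3 * exp 1) * S - 3 * exp 1 = 3 * e\<^sup>2 * (D + 2 * E - 1)"
  proof -
    have C: "C = e * (D + E) / 2"
    proof -
      have "sqrt 3 * (2 * C) = sqrt 3 * (e * (D + E))"
        using Deq Eeq by (simp add: algebra_simps)
      then show ?thesis by simp
    qed
    have S: "sqrt 3 * S = 3 * e * (E - D) / 2"
    proof -
      have "2 * S = sqrt 3 * (e * (E - D))"
        using Deq Eeq by (simp add: algebra_simps)
      then have "sqrt 3 * (2 * S) = (sqrt 3 * sqrt 3) * (e * (E - D))"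
        by (simp only: mult.assoc)
      then show ?thesis by simp
    qed
    have "9 * sqrt (exp 1) * C + sqrt (3 * exp 1) * S - 3 * exp 1 = 9 * e * C + e * (sqrt 3 * S) - 3 * e\<^sup>2"
      unfolding roots by (simp add: e(2))
    also have "\<dots> = 3 * e\<^sup>2 * (D + 2 * E - 1)"
      unfolding S by (simp add: C power2_eq_square field_simps)
    finally show ?thesis .
  qed
  moreover have "(sqrt 3 * C - S)\<^sup>2 = 3 * e\<^sup>2 * D\<^sup>2"
    by (simp add: Deq power_mult_distrib)
  ultimately have var: "(D + 2 * E - 1) / D\<^sup>2 =
      (9 * sqrt (exp 1) * C + sqrt (3 * exp 1) * S - 3 * exp 1) / (sqrt 3 * C - S)\<^sup>2"
    using e(1) by simp
  note bounds = moment_bounds[OF recip_series_approx[OF D] recip_deriv_series_approx[OF E]]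
  show ?thesis
    unfolding T_def
    using AE_increasing_triple moments(1,3) mv(2,3) mean var bounds by simp
qed

end
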